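(* Let $k,n\in\mathbb{N}$ with $k>2$ and $n>1$. Then $$(k-2)\cdot ah(k,n-1)-k+3 \;<\; ah(k,n)\;\le\; k\cdot ah(k,n-1)-k-1.$$
   Context: For $k,n\in\mathbb{N}$, $[k]=\{1,\dots,k\}$ and $[k]^n$ is the set of words $x=(x_1,\dots,x_n)$ with $x_i\in[k]$. A combinatorial line is determined by a word $w\in([k]\cup\{*\})^n$ containing at least one $*$; it consists of the $k$ points $w(1),\dots,w(k)$, where $w(i)$ is obtained from $w$ by replacing every $*$ by $i$. An $r$-coloring of $[k]^n$ is a coloring of all points of $[k]^n$ using exactly $r$ colors. A combinatorial line is rainbow if its $k$ points receive $k$ pairwise different colors; a coloring is rainbow-free if it has no rainbow combinatorial line. The anti-Hales–Jewett number $ah(k,n)$ is the least $r$ such that every $r$-coloring of $[k]^n$ contains a rainbow combinatorial line. *)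

theory Defs
  imports Main
begin

definition cube :: "nat \<Rightarrow> nat \<Rightarrow> nat list set" where
  "cube k n = {x. length x = n \<and> set x \<subseteq> {1..k}}"

text \<open>Words over \<open>[k] \<union> {*}\<close> containing at least one \<open>*\<close>; the symbol \<open>*\<close> is encoded as \<open>None\<close>.\<close>

definition line_words :: "nat \<Rightarrow> nat \<Rightarrow> nat option list set" where
  "line_words k n = {w. length w = n \<and> set w \<subseteq> Some ` {1..k} \<union> {None} \<and> None \<in> set w}"

definition fill :: "nat option list \<Rightarrow> nat \<Rightarrow> nat list" where
  "fill w i = map (\<lambda>a. case a of None \<Rightarrow> i | Some j \<Rightarrow> j) w"

definition line_of :: "nat \<Rightarrow> nat option list \<Rightarrow> nat list set" where
  "line_of k w = fill w ` {1..k}"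

definition combinatorial_line :: "nat \<Rightarrow> nat \<Rightarrow> nat list set \<Rightarrow> bool" where
  "combinatorial_line k n L \<longleftrightarrow> (\<exists>w \<in> line_words k n. L = line_of k w)"

text \<open>Colors are natural numbers, which is no restriction since the cube is finite. Values of
  a coloring outside the cube are irrelevant, and "exactly \<open>r\<close> colors" refers to the colors that
  actually occur on the cube.\<close>

definition coloring :: "nat \<Rightarrow> nat \<Rightarrow> nat \<Rightarrow> (nat list \<Rightarrow> nat) \<Rightarrow> bool" where
  "coloring k n r c \<longleftrightarrow> card (c ` cube k n) = r"

definition rainbow :: "(nat list \<Rightarrow> nat) \<Rightarrow> nat list set \<Rightarrow> bool" where
  "rainbow c L \<longleftrightarrow> inj_on c L"

text \<open>The number of colors has to be positive: a nonempty cube has no coloring with 0 colors, so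
  \<open>r = 0\<close> would satisfy the defining condition vacuously. The minimum exists: for \<open>r > k ^ n\<close>
  there is no \<open>r\<close>-coloring.\<close>

definition ah :: "nat \<Rightarrow> nat \<Rightarrow> nat" where
  "ah k n = (LEAST r. r \<ge> 1 \<and>
     (\<forall>c. coloring k n r c \<longrightarrow> (\<exists>L. combinatorial_line k n L \<and> rainbow c L)))"

end

theory Submission
  imports Defs
begin

text \<open>Let \<open>M\<^sub>n\<close> be the largest number of colors of a rainbow-free coloring of \<open>[k]\<^sup>n\<close>. Merging
  color classes keeps a coloring rainbow-free, so \<open>ah k n = M\<^sub>n + 1\<close>, and the claim becomes
  \<open>(k - 2) M\<^bsub>n-1\<^esub> + 1 \<le> M\<^sub>n \<le> k M\<^bsub>n-1\<^esub> - 2\<close>. Split \<open>[k]\<^sup>n\<close> into the \<open>k\<close> layers given by one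
  coordinate. For the lower bound, color \<open>k - 2\<close> layers by copies of an optimal coloring in
  disjoint color sets and give the other two layers one new common color, so that no line crossing
  all layers is rainbow. For the upper bound, each layer has at most \<open>M\<^bsub>n-1\<^esub>\<close> colors. Every line
  perpendicular to the layers repeats a color, and therefore yields a color of some layer that is
  already present in an earlier one. If this happens for two different pairs of layer and
  color, two colors are saved. Otherwise one layer is monochromatic, which saves
  \<open>M\<^bsub>n-1\<^esub> - 1 \<ge> 1\<close> colors on top of the repeated one.\<close>

text \<open>The repeated pair is ordered because the upper bound needs to know which of the two
  layers comes later.\<close>

definition rainbow_free :: "nat \<Rightarrow> nat \<Rightarrow> (nat list \<Rightarrow> nat) \<Rightarrow> bool" where
  "rainbow_free k n c \<longleftrightarrow>
     (\<forall>w \<in> line_words k n. \<exists>i \<in> {1..k}. \<exists>j \<in> {1..k}. i < j \<and> c (fill w i) = c (fill w j))"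

lemma rainbow_freeE:
  assumes "rainbow_free k n c" "w \<in> line_words k n"
  obtains i j where "i \<in> {1..k}" "j \<in> {1..k}" "i < j" "c (fill w i) = c (fill w j)"
  using assms unfolding rainbow_free_def by blast

lemma inj_fill: "None \<in> set w \<Longrightarrow> inj (fill w)"
  by (auto simp: inj_def fill_def)

lemma rainbow_line_of_iff:
  assumes "None \<in> set w"
  shows "rainbow c (line_of k w) \<longleftrightarrow> inj_on (\<lambda>i. c (fill w i)) {1..k}"
proof -
  have "inj_on (fill w) {1..k}"
    using inj_fill[OF assms] inj_on_subset by blast
  then show ?thesis
    using comp_inj_on_iff[of "fill w" "{1..k}" c] by (simp add: rainbow_def line_of_def comp_def)
qed

lemma rainbow_free_iff:
  "rainbow_free k n c \<longleftrightarrow> \<not> (\<exists>L. combinatorial_line k n L \<and> rainbow c L)"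
proof -
  have "(\<exists>L. combinatorial_line k n L \<and> rainbow c L) \<longleftrightarrow>
      (\<exists>w \<in> line_words k n. inj_on (\<lambda>i. c (fill w i)) {1..k})"
    by (auto simp: combinatorial_line_def line_words_def rainbow_line_of_iff)
  moreover have "inj_on f A \<longleftrightarrow> (\<forall>i \<in> A. \<forall>j \<in> A. i < j \<longrightarrow> f i \<noteq> f j)"
    for f :: "nat \<Rightarrow> nat" and A
    unfolding inj_on_def by (metis linorder_neqE_nat less_irrefl)
  ultimately show ?thesis
    unfolding rainbow_free_def by simp
qed

lemma rainbow_free_comp: "rainbow_free k n c \<Longrightarrow> rainbow_free k n (f \<circ> c)"
  unfolding rainbow_free_def comp_def by metis

lemma finite_cube [simp]: "finite (cube k n)"
  using finite_lists_length_eq[of "{1..k}" n] by (simp add: cube_def conj_commute)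

lemma card_cube: "card (cube k n) = k ^ n"
  using card_lists_length_eq[of "{1..k}" n] by (simp add: cube_def conj_commute)

lemma Cons_in_cube_iff: "i # v \<in> cube k (Suc n) \<longleftrightarrow> i \<in> {1..k} \<and> v \<in> cube k n"
  by (auto simp: cube_def)

lemma cube_Suc: "cube k (Suc n) = (\<lambda>(i, v). i # v) ` ({1..k} \<times> cube k n)"
  by (force simp: cube_def length_Suc_conv image_iff)

lemma fill_map_Some: "fill (None # map Some v) i = i # v"
  by (simp add: fill_def comp_def)

lemma None_Cons_line_word: "v \<in> cube k n \<Longrightarrow> None # map Some v \<in> line_words k (Suc n)"
  by (auto simp: cube_def line_words_def)

lemma Some_Cons_line_word:
  "Some i # w \<in> line_words k (Suc n) \<longleftrightarrow> i \<in> {1..k} \<and> w \<in> line_words k n"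
  by (auto simp: line_words_def)

text \<open>Keep \<open>r\<close> of the colors and merge all others into one of them,
  \<open>t\<close>; equal colors on a line stay equal.\<close>

lemma fewer_colors:
  assumes "rainbow_free k n c" "1 \<le> r" "r \<le> card (c ` cube k n)"
  obtains d where "rainbow_free k n d" "coloring k n r d"
proof -
  obtain T where T: "T \<subseteq> c ` cube k n" "card T = r"
    using obtain_subset_with_card_n[OF assms(3)] by metis
  then obtain t where t: "t \<in> T"
    using assms(2) by fastforce
  define f where "f x = (if x \<in> T then x else t)" for x
  have "f ` (c ` cube k n) = T"
    using T t by (force simp: f_def)
  then have "coloring k n r (f \<circ> c)"
    using T by (simp add: coloring_def image_comp)
  then show ?thesis
    using that rainbow_free_comp[OF assms(1)] by blast
qed

lemma ah_eq:
  "ah k n = (LEAST r. r \<ge> 1 \<and> (\<forall>c. coloring k n r c \<longrightarrow> \<not> rainbow_free k n c))"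
  by (simp add: ah_def rainbow_free_iff)

lemma ah_forces_rainbow: "ah k n \<ge> 1" "coloring k n (ah k n) c \<Longrightarrow> \<not> rainbow_free k n c"
proof -
  have "card (c ` cube k n) < Suc (k ^ n)" for c
    using card_image_le[of "cube k n" c] by (simp add: card_cube)
  then have "\<not> coloring k n (Suc (k ^ n)) c" for c
    unfolding coloring_def by (metis less_irrefl)
  then have "\<exists>r\<ge>1. \<forall>c. coloring k n r c \<longrightarrow> \<not> rainbow_free k n c"
    \<comment> \<open>With more colors than points the condition is vacuous, so the least
      \<open>r\<close> exists.\<close>
    by (intro exI[of _ "Suc (k ^ n)"]) auto
  from LeastI_ex[OF this, folded ah_eq]
  show "ah k n \<ge> 1" "coloring k n (ah k n) c \<Longrightarrow> \<not> rainbow_free k n c" by auto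
qed

lemma card_colors_less_ah:
  assumes "rainbow_free k n c"
  shows "card (c ` cube k n) < ah k n"
  using assms fewer_colors ah_forces_rainbow by (metis not_le)

text \<open>Since \<open>ah k n - 1\<close> is still positive, minimality can fail for it only
  through a rainbow-free coloring.\<close>

lemma optimal_coloring:
  assumes "ah k n > 1"
  obtains c where "rainbow_free k n c" "card (c ` cube k n) = ah k n - 1"
proof -
  have "ah k n - 1 < ah k n" using assms by simp
  from not_less_Least[OF this[unfolded ah_eq], folded ah_eq] show ?thesis
    using that assms by (auto simp: coloring_def)
qed

text \<open>Two colors cannot make a line of at least three points rainbow.\<close>

lemma ah_ge_3:
  assumes "k > 2"
  shows "ah k (Suc n) \<ge> 3"
proof -
  define c :: "nat list \<Rightarrow> nat" where "c x = (if hd x = 1 then 0 else 1)" for x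
  have "replicate (Suc n) 1 \<in> cube k (Suc n)" "replicate (Suc n) 2 \<in> cube k (Suc n)"
    using assms by (auto simp: cube_def)
  from this[THEN imageI, of c] have "{0, 1} \<subseteq> c ` cube k (Suc n)"
    by (simp add: c_def)
  from card_mono[OF _ this] have card: "2 \<le> card (c ` cube k (Suc n))"
    by simp
  have "rainbow_free k (Suc n) c"
    unfolding rainbow_free_def
  proof
    fix w
    have in_01: "c x = 0 \<or> c x = 1" for x by (simp add: c_def)
    have "c (fill w 1) = c (fill w 2) \<or> c (fill w 1) = c (fill w 3) \<or> c (fill w 2) = c (fill w 3)"
      using in_01[of "fill w 1"] in_01[of "fill w 2"] in_01[of "fill w 3"] by linarith
    then have "\<exists>i\<in>{1, 2, 3}. \<exists>j\<in>{1, 2, 3}. i < j \<and> c (fill w i) = c (fill w j)"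
      by auto
    moreover have "{1, 2, 3} \<subseteq> {1..k}" using assms by auto
    ultimately show "\<exists>i\<in>{1..k}. \<exists>j\<in>{1..k}. i < j \<and> c (fill w i) = c (fill w j)"
      by blast
  qed
  from card_colors_less_ah[OF this] card show ?thesis by simp
qed

lemma ex_coloring_Suc:
  assumes "k > 2" "rainbow_free k n c"
  obtains d where "rainbow_free k (Suc n) d"
    "card (d ` cube k (Suc n)) \<ge> (k - 2) * card (c ` cube k n) + 1"
proof -
  \<comment> \<open>Encodes a pair of layer and color as one number. Layers lie in
    \<open>{1..k - 2}\<close>: below \<open>k\<close>, so \<open>mod\<close> and \<open>div\<close>
    decode the pair; nonzero, so 0 stays free for the layers \<open>k - 1\<close> and
    \<open>k\<close>.\<close>
  define e where "e p = fst p + k * snd p" for p :: "nat \<times> nat"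
  define d where "d x = (if hd x \<ge> k - 1 then 0 else e (hd x, c (tl x)))" for x
  have "rainbow_free k (Suc n) d"
    unfolding rainbow_free_def
  proof
    fix u assume u: "u \<in> line_words k (Suc n)"
    then obtain a w where aw: "u = a # w"
      by (auto simp: line_words_def length_Suc_conv)
    show "\<exists>i\<in>{1..k}. \<exists>j\<in>{1..k}. i < j \<and> d (fill u i) = d (fill u j)"
    proof (cases a)
      case None
      have "d (fill u (k - 1)) = d (fill u k)"
        by (simp add: aw None d_def fill_def)
      moreover have "k - 1 \<in> {1..k}" "k \<in> {1..k}" "k - 1 < k" using assms by auto
      ultimately show ?thesis by blast
    next
      case (Some i)
      then have "w \<in> line_words k n"
        using u aw Some_Cons_line_word by simp
      from rainbow_freeE[OF assms(2) this] show ?thesis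
        \<comment> \<open>On a fixed layer, \<open>d\<close> is a function of the color that
          \<open>c\<close> gives to the tail, so the repetition under \<open>c\<close> carries
          over.\<close>
        by (metis (no_types, lifting) aw Some d_def fill_def list.map(2) list.sel(1,3) option.case(2))
    qed
  qed
  moreover have "card (d ` cube k (Suc n)) \<ge> (k - 2) * card (c ` cube k n) + 1"
  proof -
    let ?P = "{1..k - 2} \<times> c ` cube k n"
    have mod: "e p mod k = fst p" "e p div k = snd p" if "p \<in> ?P" for p
      using that assms by (auto simp: e_def)
    then have "inj_on e ?P"
      by (metis inj_onI prod_eq_iff)
    then have "card (e ` ?P) = (k - 2) * card (c ` cube k n)"
      by (simp add: card_image card_cartesian_product)
    moreover have "0 \<notin> e ` ?P"
      by (auto simp: e_def)
    ultimately have "card (insert 0 (e ` ?P)) = (k - 2) * card (c ` cube k n) + 1"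
      by simp
    moreover have "insert 0 (e ` ?P) \<subseteq> d ` cube k (Suc n)"
    proof -
      have "d (replicate (Suc n) k) = 0" by (simp add: d_def)
      moreover have "replicate (Suc n) k \<in> cube k (Suc n)"
        using assms by (auto simp: cube_def)
      moreover have "e (i, c v) \<in> d ` cube k (Suc n)" if "i \<in> {1..k - 2}" "v \<in> cube k n" for i v
      proof
        show "e (i, c v) = d (i # v)" using that assms by (auto simp: d_def)
        show "i # v \<in> cube k (Suc n)" using that assms by (auto simp: Cons_in_cube_iff)
      qed
      ultimately show ?thesis by (auto simp: image_iff)
    qed
    ultimately show ?thesis
      by (metis card_mono finite_cube finite_imageI)
  qed
  ultimately show ?thesis using that by blast
qed

lemma rainbow_free_layer:
  assumes "rainbow_free k (Suc n) c" "i \<in> {1..k}"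
  shows "rainbow_free k n (\<lambda>v. c (i # v))"
  unfolding rainbow_free_def
proof
  fix w assume "w \<in> line_words k n"
  then have "Some i # w \<in> line_words k (Suc n)"
    using assms(2) Some_Cons_line_word by simp
  from rainbow_freeE[OF assms(1) this]
  show "\<exists>j\<in>{1..k}. \<exists>l\<in>{1..k}. j < l \<and> c (i # fill w j) = c (i # fill w l)"
    by (metis fill_def list.map(2) option.case(2))
qed

lemma card_colors_Suc_le:
  fixes M :: nat
  assumes "k > 2" "rainbow_free k (Suc n) c" "M \<ge> 2"
    and layer: "\<And>d. rainbow_free k n d \<Longrightarrow> card (d ` cube k n) \<le> M"
  shows "card (c ` cube k (Suc n)) + 2 \<le> k * M"
proof -
  define C where "C i = (\<lambda>v. c (i # v)) ` cube k n" for i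
  define D where "D = (SIGMA i:{1..k}. C i)"
  \<comment> \<open>\<open>D\<close> counts each color once per layer in which it occurs;
    \<open>R\<close> collects the recurrences. Removing \<open>R\<close> leaves the first occurrence
    of every color, so \<open>card R\<close> colors are saved.\<close>
  define R where "R = {(b, \<gamma>) \<in> D. \<exists>a \<in> {1..k}. a < b \<and> \<gamma> \<in> C a}"
  have fin_C: "finite (C i)" for i by (simp add: C_def)
  have fin_D: "finite D" by (simp add: D_def fin_C)
  have "R \<subseteq> D" by (auto simp: R_def)
  then have fin_R: "finite R" using fin_D finite_subset by blast
  have card_C: "card (C i) \<le> M" if "i \<in> {1..k}" for i
    using layer[OF rainbow_free_layer[OF assms(2) that]] by (simp add: C_def)
  have card_D: "card D = (\<Sum>i\<in>{1..k}. card (C i))"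
    by (simp add: D_def fin_C)
  have colors: "c ` cube k (Suc n) \<subseteq> snd ` (D - R)"
  proof
    fix \<gamma> assume "\<gamma> \<in> c ` cube k (Suc n)"
    then have ex: "\<exists>i. i \<in> {1..k} \<and> \<gamma> \<in> C i"
      by (auto simp: cube_Suc C_def)
    define b where "b = (LEAST i. i \<in> {1..k} \<and> \<gamma> \<in> C i)"
    have "b \<in> {1..k} \<and> \<gamma> \<in> C b" unfolding b_def by (rule LeastI_ex[OF ex])
    moreover have "\<not> (a \<in> {1..k} \<and> \<gamma> \<in> C a)" if "a < b" for a
      using not_less_Least that unfolding b_def by blast
    ultimately have "(b, \<gamma>) \<in> D - R" by (auto simp: D_def R_def)
    then show "\<gamma> \<in> snd ` (D - R)" by force
  qed
  have "card (c ` cube k (Suc n)) \<le> card (D - R)"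
    using surj_card_le[OF _ colors] fin_D by simp
  also have "\<dots> = card D - card R"
    using card_Diff_subset[OF fin_R \<open>R \<subseteq> D\<close>] .
  finally have saved: "card (c ` cube k (Suc n)) + card R \<le> card D"
    using card_mono[OF fin_D \<open>R \<subseteq> D\<close>] by simp
  have repeated: "\<exists>b. (b, c (b # v)) \<in> R" if v: "v \<in> cube k n" for v
  proof -
    from rainbow_freeE[OF assms(2) None_Cons_line_word[OF v]]
    obtain a b where "a \<in> {1..k}" "b \<in> {1..k}" "a < b" "c (a # v) = c (b # v)"
      by (metis fill_map_Some)
    moreover have "c (a # v) \<in> C a" "c (b # v) \<in> C b"
      using v by (auto simp: C_def)
    ultimately have "(b, c (b # v)) \<in> R"
      by (auto simp: R_def D_def)
    then show ?thesis ..
  qed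
  show ?thesis
  proof (cases "card R \<ge> 2")
    case True
    have "card D \<le> k * M"
      using sum_bounded_above[of "{1..k}" "\<lambda>i. card (C i)" M] card_C card_D by simp
    with True saved show ?thesis by linarith
  next
    case False
    have "replicate n 1 \<in> cube k n" using assms by (auto simp: cube_def)
    from repeated[OF this] have "R \<noteq> {}" by auto
    then have "card R > 0" using fin_R by (simp add: card_gt_0_iff)
    then have "card R = 1" using False by linarith
    then obtain b \<gamma> where R: "R = {(b, \<gamma>)}" by (metis card_1_singletonE surj_pair)
    then have b: "b \<in> {1..k}" using \<open>R \<subseteq> D\<close> by (auto simp: D_def)
    \<comment> \<open>Each perpendicular line yields an element of \<open>R\<close>. As there is
      only one, every point \<open>b # v\<close> has color \<open>\<gamma>\<close>.\<close>
    have "C b \<subseteq> {\<gamma>}" using repeated R by (auto simp: C_def)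
    then have "card (C b) \<le> 1" using card_mono[of "{\<gamma>}"] by fastforce
    moreover have "(\<Sum>i\<in>{1..k} - {b}. card (C i)) \<le> (k - 1) * M"
      using sum_bounded_above[of "{1..k} - {b}" "\<lambda>i. card (C i)" M] card_C b by simp
    ultimately have "card D \<le> 1 + (k - 1) * M"
      using card_D sum.remove[of "{1..k}" b "\<lambda>i. card (C i)"] b by simp
    moreover have "k * M = M + (k - 1) * M"
      using assms(1) by (cases k) auto
    \<comment> \<open>Layer \<open>b\<close> costs at most 1 instead of \<open>M\<close>, and
      \<open>R\<close> saves one more: at most \<open>(k - 1) * M\<close> colors, which suffices as
      \<open>M \<ge> 2\<close>.\<close>
    ultimately show ?thesis
      using saved \<open>card R = 1\<close> assms(3) by linarith
  qed
qed

theorem theorem2p1: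
  fixes k n :: nat
  assumes "k > 2" and "n > 1"
  shows "(int k - 2) * int (ah k (n - 1)) - int k + 3 < int (ah k n)
       \<and> int (ah k n) \<le> int k * int (ah k (n - 1)) - int k - 1"
proof -
  obtain m where n: "n = Suc m" and "m \<ge> 1"
    using assms(2) by (cases n) auto
  define M where "M = ah k m - 1"
  define N where "N = ah k n - 1"
  \<comment> \<open>Here \<open>n > 1\<close> enters: the layers have dimension at least 1, which
    yields \<open>M \<ge> 2\<close>.\<close>
  have "ah k m \<ge> 3"
    using ah_ge_3[OF assms(1), of "m - 1"] \<open>m \<ge> 1\<close> by simp
  then have M: "int (ah k m) = int M + 1" "M \<ge> 2" by (auto simp: M_def)
  have "ah k n \<ge> 3"
    using ah_ge_3[OF assms(1), of m] n by simp
  then have N: "int (ah k n) = int N + 1" "ah k n > 1" by (auto simp: N_def)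
  obtain c where "rainbow_free k m c" "card (c ` cube k m) = M"
    using optimal_coloring[of k m] \<open>ah k m \<ge> 3\<close> M_def by auto
  then obtain d where "rainbow_free k n d" "(k - 2) * M + 1 \<le> card (d ` cube k n)"
    using ex_coloring_Suc[OF assms(1)] n by metis
  with card_colors_less_ah have "(k - 2) * M + 1 \<le> N"
    unfolding N_def by fastforce
  then have "int ((k - 2) * M + 1) \<le> int N" by (simp only: of_nat_le_iff)
  then have lower: "(int k - 2) * int M + 1 \<le> int N"
    using assms(1) by (simp add: of_nat_diff)
  obtain e where "rainbow_free k n e" "card (e ` cube k n) = N"
    using optimal_coloring[OF N(2)] N_def by auto
  moreover have "card (d ` cube k m) \<le> M" if "rainbow_free k m d" for d
    using card_colors_less_ah[OF that] M_def by simp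
  ultimately have "N + 2 \<le> k * M"
    using card_colors_Suc_le[OF assms(1)] M(2) n by metis
  then have "int (N + 2) \<le> int (k * M)" by (simp only: of_nat_le_iff)
  then have upper: "int N + 2 \<le> int k * int M" by simp
  show ?thesis
    \<comment> \<open>Substituting \<open>M + 1\<close> and \<open>N + 1\<close> for the two values
      of \<open>ah\<close> turns the claim into \<open>lower\<close> and
      \<open>upper\<close>.\<close>
    using lower upper M(1) N(1) n by (simp add: algebra_simps)
qed

end
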